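(* Let $\Omega\subset\mathbb{R}^3$ be a bounded domain with smooth boundary surface $S$, let $\mathbf{n}(\mathbf{x})$ denote the outward unit normal at $\mathbf{x}\in S$, and let $f:S\to\mathbb{R}$ be smooth. Let $\mathbf{y}\in S$. Then the integrand of the modified adjoint double layer potential, $$\mathbf{x}\ \mapsto\ \frac{\bigl(f(\mathbf{x})\,\mathbf{n}(\mathbf{y})+f(\mathbf{y})\,\mathbf{n}(\mathbf{x})\bigr)\cdot(\mathbf{y}-\mathbf{x})}{4\pi|\mathbf{x}-\mathbf{y}|^3},\qquad \mathbf{x}\in S\setminus\{\mathbf{y}\},$$ is bounded at $\mathbf{x}=\mathbf{y}$, i.e. it is bounded on $(S\cap U)\setminus\{\mathbf{y}\}$ for some neighborhood $U$ of $\mathbf{y}$.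
   Context: The adjoint double layer potential of the density $f$ at $\mathbf{y}\in S$ is $v(\mathbf{y})=\int_S \frac{\mathbf{n}(\mathbf{y})\cdot(\mathbf{y}-\mathbf{x})}{4\pi|\mathbf{x}-\mathbf{y}|^3}f(\mathbf{x})\,dS(\mathbf{x})$. Its modified form is $$v(\mathbf{y})=\int_S \frac{\bigl(f(\mathbf{x})\mathbf{n}(\mathbf{y})+f(\mathbf{y})\mathbf{n}(\mathbf{x})\bigr)\cdot(\mathbf{y}-\mathbf{x})}{4\pi|\mathbf{x}-\mathbf{y}|^3}\,dS(\mathbf{x})+\tfrac12 f(\mathbf{y}).$$ *)

theory Defs
  imports "HOL-Analysis.Analysis"
begin

(* Class C^k on an open set: all partial derivatives up to order k exist and are continuous
   (total differentiability follows at each lower order, so requiring it changes nothing).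
   Only meant for open sets, since derivatives are taken with respect to the full space. *)
primrec Ck_on :: "nat \<Rightarrow> 'a::euclidean_space set \<Rightarrow> ('a \<Rightarrow> 'b::real_normed_vector) \<Rightarrow> bool" where
  "Ck_on 0 U f \<longleftrightarrow> continuous_on U f"
| "Ck_on (Suc k) U f \<longleftrightarrow> (\<forall>x\<in>U. f differentiable (at x)) \<and>
     (\<forall>e\<in>Basis. Ck_on k U (\<lambda>x. frechet_derivative f (at x) e))"

definition smooth_on_open :: "'a::euclidean_space set \<Rightarrow> ('a \<Rightarrow> 'b::real_normed_vector) \<Rightarrow> bool" where
  "smooth_on_open U f \<longleftrightarrow> open U \<and> (\<forall>k. Ck_on k U f)"

(* Near each boundary point the boundary is a regular level set of a smooth function, and
   the set lies on one side of it. *)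
definition smooth_boundary :: "'a::euclidean_space set \<Rightarrow> bool" where
  "smooth_boundary \<Omega> \<longleftrightarrow>
     (\<forall>p\<in>frontier \<Omega>. \<exists>U (\<rho> :: 'a \<Rightarrow> real).
        p \<in> U \<and> smooth_on_open U \<rho> \<and>
        (\<forall>x\<in>U. frechet_derivative \<rho> (at x) \<noteq> (\<lambda>v. 0)) \<and>
        \<Omega> \<inter> U = {x\<in>U. \<rho> x < 0} \<and>
        frontier \<Omega> \<inter> U = {x\<in>U. \<rho> x = 0})"

definition bounded_smooth_domain :: "'a::euclidean_space set \<Rightarrow> bool" where
  "bounded_smooth_domain \<Omega> \<longleftrightarrow>
     \<Omega> \<noteq> {} \<and> open \<Omega> \<and> connected \<Omega> \<and> bounded \<Omega> \<and> smooth_boundary \<Omega>"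

(* A function on a subset S is smooth if it is locally the restriction of a smooth function
   on the ambient space; the values of f off S are irrelevant. *)
definition smooth_on_surface :: "'a::euclidean_space set \<Rightarrow> ('a \<Rightarrow> 'b::real_normed_vector) \<Rightarrow> bool" where
  "smooth_on_surface S f \<longleftrightarrow>
     (\<forall>p\<in>S. \<exists>U g. p \<in> U \<and> smooth_on_open U g \<and> (\<forall>x\<in>S \<inter> U. f x = g x))"

(* Velocities at x of curves in S through x; for a smooth hypersurface this is the usual
   tangent space. *)
definition tangent_vectors :: "'a::euclidean_space set \<Rightarrow> 'a \<Rightarrow> 'a set" where
  "tangent_vectors S x =
     {v. \<exists>c :: real \<Rightarrow> 'a. c 0 = x \<and> (\<forall>\<^sub>F t in at 0. c t \<in> S) \<and> (c has_vector_derivative v) (at 0)}"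

definition is_outward_unit_normal :: "'a::euclidean_space set \<Rightarrow> 'a \<Rightarrow> 'a \<Rightarrow> bool" where
  "is_outward_unit_normal \<Omega> x \<nu> \<longleftrightarrow>
     norm \<nu> = 1 \<and>
     (\<forall>v\<in>tangent_vectors (frontier \<Omega>) x. \<nu> \<bullet> v = 0) \<and>
     (\<forall>\<^sub>F t in at_right 0. x + t *\<^sub>R \<nu> \<notin> closure \<Omega>)"

definition modified_adjoint_integrand ::
    "(real^3 \<Rightarrow> real^3) \<Rightarrow> (real^3 \<Rightarrow> real) \<Rightarrow> real^3 \<Rightarrow> real^3 \<Rightarrow> real" where
  "modified_adjoint_integrand n f y x =
     ((f x *\<^sub>R n y + f y *\<^sub>R n x) \<bullet> (y - x)) / (4 * pi * norm (x - y) ^ 3)"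

end

theory Submission
  imports Defs
begin

text \<open>
  Near \<open>y\<close> the surface is the zero set of a smooth \<open>\<rho>\<close> with nonvanishing gradient, and the
  outward unit normal is \<open>\<nabla>\<rho> / |\<nabla>\<rho>|\<close> (\<open>outward_unit_normal_eq_normalized_grad\<close>).  With
  \<open>a = 1 / |\<nabla>\<rho>(x)|\<close>, \<open>b = 1 / |\<nabla>\<rho>(y)|\<close> and \<open>d = |x - y|\<close>, the numerator of the integrand is
  \<open>(f(x) - f(y)) b \<nabla>\<rho>(y) \<bullet> (y - x)
     + f(y) (a (\<nabla>\<rho>(x) + \<nabla>\<rho>(y)) \<bullet> (y - x) + (b - a) \<nabla>\<rho>(y) \<bullet> (y - x))\<close>.
  Since \<open>\<rho>\<close> vanishes at \<open>x\<close> and \<open>y\<close>, second-order Taylor expansion (\<open>quadratic_taylor\<close>) gives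
  \<open>\<nabla>\<rho>(y) \<bullet> (y - x) = O(d^2)\<close>.  For the same reason
  \<open>(\<nabla>\<rho>(x) + \<nabla>\<rho>(y)) \<bullet> (y - x)\<close> is, up to a factor 2, the error of the trapezoidal rule for the
  integral of the derivative of \<open>\<rho>\<close> along the segment from \<open>x\<close> to \<open>y\<close>, hence \<open>O(d^3)\<close>
  (\<open>trapezoidal_rule_error\<close>).  The remaining factors \<open>f(x) - f(y)\<close> and \<open>b - a\<close> are \<open>O(d)\<close> by
  \<open>Ck_on_1_lipschitz\<close> and \<open>grad_lipschitz\<close>.  So every term is \<open>O(d^3)\<close>, which the denominator
  cancels.  This is what adding \<open>f(y) n(x)\<close> buys: either normal alone gives only \<open>O(d^2)\<close>.

  The Taylor estimates must hold with constants uniform in both end points.  They come from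
  Maclaurin's formula along segments, applied to iterated directional derivatives, together
  with a bound of the form \<open>M |h|^m\<close> for the \<open>m\<close>-th derivative in direction \<open>h\<close>
  (\<open>dirderiv_iterate_bound\<close>).
\<close>

section \<open>Iterated directional derivatives\<close>

definition dirderiv :: "'a::euclidean_space \<Rightarrow> ('a \<Rightarrow> real) \<Rightarrow> 'a \<Rightarrow> real" where
  "dirderiv h f = (\<lambda>x. frechet_derivative f (at x) h)"

lemma Ck_on_dirderiv_Basis:
  "Ck_on (Suc k) U f \<longleftrightarrow> (\<forall>x\<in>U. f differentiable (at x)) \<and> (\<forall>e\<in>Basis. Ck_on k U (dirderiv e f))"
  by (simp add: dirderiv_def)

text \<open>
  The predicate \<open>Ck_on\<close> inspects derivatives with respect to the whole space, so replacing a
  function by one that agrees with it only on \<open>U\<close> needs \<open>U\<close> to be open.  The replacement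
  occurs below because a derivative is a linear combination of partial derivatives only where
  the function is differentiable.
\<close>

lemma dirderiv_cong:
  assumes "open U" "\<And>x. x \<in> U \<Longrightarrow> f x = g x" "x \<in> U"
  shows "dirderiv h f x = dirderiv h g x"
proof -
  have "(f has_derivative D) (at x) \<longleftrightarrow> (g has_derivative D) (at x)" for D
    using assms(2) by (auto elim!: has_derivative_transform_within_open[OF _ assms(1,3)])
  then show ?thesis unfolding dirderiv_def frechet_derivative_def by simp
qed

lemma Ck_on_cong:
  fixes f g :: "'a::euclidean_space \<Rightarrow> real"
  assumes "open U" "\<And>x. x \<in> U \<Longrightarrow> f x = g x" "Ck_on k U f"
  shows "Ck_on k U g"
  using assms(2,3)
proof (induction k arbitrary: f g)
  case 0
  then show ?case using continuous_on_eq[of U f g] by simp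
next
  case (Suc k)
  have "g differentiable (at x)" if "x \<in> U" for x
  proof -
    obtain D where "(f has_derivative D) (at x)"
      using Suc.prems(2) \<open>x \<in> U\<close> unfolding Ck_on_dirderiv_Basis differentiable_def by blast
    then have "(g has_derivative D) (at x)"
      by (rule has_derivative_transform_within_open[OF _ assms(1) that Suc.prems(1)])
    then show ?thesis unfolding differentiable_def by blast
  qed
  moreover have "Ck_on k U (dirderiv e g)" if "e \<in> Basis" for e
  proof (rule Suc.IH)
    show "Ck_on k U (dirderiv e f)"
      using Suc.prems(2) that unfolding Ck_on_dirderiv_Basis by blast
  qed (rule dirderiv_cong[OF assms(1) Suc.prems(1)])
  ultimately show ?case unfolding Ck_on_dirderiv_Basis by blast
qed

lemma Ck_on_Suc_imp:
  fixes f :: "'a::euclidean_space \<Rightarrow> real"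
  shows "Ck_on (Suc k) U f \<Longrightarrow> Ck_on k U f"
proof (induction k arbitrary: f)
  case 0
  then show ?case
    by (auto intro!: continuous_at_imp_continuous_on differentiable_imp_continuous_within)
next
  case (Suc k)
  then show ?case unfolding Ck_on_dirderiv_Basis by blast
qed

lemma Ck_on_mono:
  fixes f :: "'a::euclidean_space \<Rightarrow> real"
  assumes "Ck_on k U f" "m \<le> k"
  shows "Ck_on m U f"
  using assms(2,1) by (induction rule: dec_induct) (auto dest: Ck_on_Suc_imp simp del: Ck_on.simps)

lemma dirderiv_linear_combination:
  fixes f :: "'i \<Rightarrow> 'a::euclidean_space \<Rightarrow> real"
  assumes "\<And>i. i \<in> I \<Longrightarrow> f i differentiable (at x)"
  shows "(\<lambda>x. \<Sum>i\<in>I. c i * f i x) differentiable (at x)"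
    and "dirderiv h (\<lambda>x. \<Sum>i\<in>I. c i * f i x) x = (\<Sum>i\<in>I. c i * dirderiv h (f i) x)"
proof -
  have *: "((\<lambda>x. \<Sum>i\<in>I. c i * f i x) has_derivative
      (\<lambda>v. \<Sum>i\<in>I. c i * frechet_derivative (f i) (at x) v)) (at x)"
    by (rule has_derivative_sum, rule has_derivative_mult_right)
      (rule assms[unfolded frechet_derivative_works])
  then show "(\<lambda>x. \<Sum>i\<in>I. c i * f i x) differentiable (at x)"
    unfolding differentiable_def by blast
  show "dirderiv h (\<lambda>x. \<Sum>i\<in>I. c i * f i x) x = (\<Sum>i\<in>I. c i * dirderiv h (f i) x)"
    unfolding dirderiv_def by (simp add: frechet_derivative_at[OF *, symmetric])
qed

lemma Ck_on_linear_combination: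
  fixes f :: "'i \<Rightarrow> 'a::euclidean_space \<Rightarrow> real"
  assumes "open U" "\<And>i. i \<in> I \<Longrightarrow> Ck_on k U (f i)"
  shows "Ck_on k U (\<lambda>x. \<Sum>i\<in>I. c i * f i x)"
  using assms(2)
proof (induction k arbitrary: f)
  case 0
  then show ?case by (auto intro!: continuous_intros)
next
  case (Suc k)
  have d: "f i differentiable (at x)" if "i \<in> I" "x \<in> U" for i x
    using Suc.prems that unfolding Ck_on_dirderiv_Basis by blast
  have "Ck_on k U (dirderiv e (\<lambda>x. \<Sum>i\<in>I. c i * f i x))" if "e \<in> Basis" for e
  proof (rule Ck_on_cong[OF assms(1)])
    show "Ck_on k U (\<lambda>x. \<Sum>i\<in>I. c i * dirderiv e (f i) x)"
      using Suc.IH[of "\<lambda>i. dirderiv e (f i)"] Suc.prems that unfolding Ck_on_dirderiv_Basis by blast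
  qed (use d in \<open>simp add: dirderiv_linear_combination\<close>)
  moreover have "(\<lambda>x. \<Sum>i\<in>I. c i * f i x) differentiable (at x)" if "x \<in> U" for x
    using d that by (intro dirderiv_linear_combination(1)) blast
  ultimately show ?case unfolding Ck_on_dirderiv_Basis by blast
qed

lemma dirderiv_Basis_expansion:
  assumes "f differentiable (at x)"
  shows "dirderiv h f x = (\<Sum>e\<in>Basis. (h \<bullet> e) * dirderiv e f x)"
proof -
  let ?D = "frechet_derivative f (at x)"
  have "linear ?D" using linear_frechet_derivative[OF assms] .
  then have "?D (\<Sum>e\<in>Basis. (h \<bullet> e) *\<^sub>R e) = (\<Sum>e\<in>Basis. (h \<bullet> e) * ?D e)"
    by (simp add: linear_sum linear_cmul del: euclidean_representation)
  then show ?thesis by (simp add: dirderiv_def euclidean_representation)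
qed

text \<open>
  The definition of \<open>Ck_on\<close> speaks of basis directions only; linearity of the derivative
  carries it over to every direction.
\<close>

lemma Ck_on_dirderiv:
  assumes "open U" "Ck_on (Suc k) U f"
  shows "Ck_on k U (dirderiv h f)"
proof (rule Ck_on_cong[OF assms(1)])
  show "Ck_on k U (\<lambda>x. \<Sum>e\<in>Basis. (h \<bullet> e) * dirderiv e f x)"
    using assms unfolding Ck_on_dirderiv_Basis by (intro Ck_on_linear_combination) auto
next
  fix x assume "x \<in> U"
  then have "f differentiable (at x)" using assms(2) by simp
  then show "(\<Sum>e\<in>Basis. (h \<bullet> e) * dirderiv e f x) = dirderiv h f x"
    by (rule dirderiv_Basis_expansion[symmetric])
qed

lemma Ck_on_dirderiv_iterate:
  assumes "open U" "Ck_on (m + k) U f"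
  shows "Ck_on k U ((dirderiv h ^^ m) f)"
  using assms(2)
proof (induction m arbitrary: k)
  case (Suc m)
  then have "Ck_on (Suc k) U ((dirderiv h ^^ m) f)"
    by (simp del: Ck_on.simps)
  then show ?case
    using Ck_on_dirderiv[OF assms(1)] by simp
qed simp

lemma dirderiv_iterate_cong:
  assumes "open U" "\<And>x. x \<in> U \<Longrightarrow> f x = g x" "x \<in> U"
  shows "(dirderiv h ^^ m) f x = (dirderiv h ^^ m) g x"
  using assms(3)
proof (induction m arbitrary: x)
  case (Suc m)
  then show ?case using dirderiv_cong[OF assms(1) Suc.IH] by simp
qed (use assms(2) in simp)

lemma dirderiv_iterate_linear_combination:
  fixes f :: "'i \<Rightarrow> 'a::euclidean_space \<Rightarrow> real"
  assumes "open U" "\<And>i. i \<in> I \<Longrightarrow> Ck_on m U (f i)" "x \<in> U"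
  shows "(dirderiv h ^^ m) (\<lambda>x. \<Sum>i\<in>I. c i * f i x) x = (\<Sum>i\<in>I. c i * (dirderiv h ^^ m) (f i) x)"
  using assms(2,3)
proof (induction m arbitrary: x)
  case (Suc m)
  have d: "(dirderiv h ^^ m) (f i) differentiable (at x)" if "i \<in> I" for i
    using Ck_on_dirderiv_iterate[OF assms(1), of m 1 "f i"] Suc.prems that by auto
  have "(dirderiv h ^^ Suc m) (\<lambda>x. \<Sum>i\<in>I. c i * f i x) x
      = dirderiv h (\<lambda>x. \<Sum>i\<in>I. c i * (dirderiv h ^^ m) (f i) x) x"
    using dirderiv_cong[OF assms(1) _ Suc.prems(2),
        of "(dirderiv h ^^ m) (\<lambda>x. \<Sum>i\<in>I. c i * f i x)"
           "\<lambda>x. \<Sum>i\<in>I. c i * (dirderiv h ^^ m) (f i) x" h]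
      Suc.IH[OF Ck_on_Suc_imp[OF Suc.prems(1)]] by simp
  also have "\<dots> = (\<Sum>i\<in>I. c i * dirderiv h ((dirderiv h ^^ m) (f i)) x)"
    using d by (rule dirderiv_linear_combination)
  finally show ?case by simp
qed simp

text \<open>
  The \<open>m\<close>-th derivative in direction \<open>h\<close> is a form of degree \<open>m\<close> in the coordinates of \<open>h\<close>
  whose coefficients are the partial derivatives of order \<open>m\<close>, bounded on \<open>K\<close> by continuity.
  The induction peels off the innermost derivative, so that it applies to the partial
  derivatives of \<open>f\<close>.
\<close>

lemma dirderiv_iterate_bound:
  fixes f :: "'a::euclidean_space \<Rightarrow> real"
  assumes "open U" "compact K" "K \<subseteq> U" "Ck_on m U f"
  shows "\<exists>M\<ge>0. \<forall>h. \<forall>z\<in>K. \<bar>(dirderiv h ^^ m) f z\<bar> \<le> M * norm h ^ m"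
  using assms(4)
proof (induction m arbitrary: f)
  case 0
  then have "continuous_on K f" using assms(3) continuous_on_subset by auto
  then have "bounded (f ` K)"
    using assms(2) compact_continuous_image compact_imp_bounded by blast
  then show ?case unfolding bounded_pos by (auto intro: less_imp_le)
next
  case (Suc m)
  have C: "Ck_on m U (dirderiv e f)" if "e \<in> Basis" for e
    using Suc.prems that unfolding Ck_on_dirderiv_Basis by blast
  then have "\<forall>e\<in>Basis. \<exists>M\<ge>0. \<forall>h. \<forall>z\<in>K. \<bar>(dirderiv h ^^ m) (dirderiv e f) z\<bar> \<le> M * norm h ^ m"
    using Suc.IH by blast
  then obtain M where M: "\<And>e. e \<in> Basis \<Longrightarrow> M e \<ge> 0"
      "\<And>e h z. e \<in> Basis \<Longrightarrow> z \<in> K \<Longrightarrow> \<bar>(dirderiv h ^^ m) (dirderiv e f) z\<bar> \<le> M e * norm h ^ m"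
    by metis
  have "\<bar>(dirderiv h ^^ Suc m) f z\<bar> \<le> sum M Basis * norm h ^ Suc m" if z: "z \<in> K" for h z
  proof -
    have "(dirderiv h ^^ Suc m) f z = (dirderiv h ^^ m) (dirderiv h f) z"
      by (simp add: funpow_swap1)
    also have "\<dots> = (dirderiv h ^^ m) (\<lambda>x. \<Sum>e\<in>Basis. (h \<bullet> e) * dirderiv e f x) z"
      using Suc.prems z assms(3) unfolding Ck_on_dirderiv_Basis
      by (intro dirderiv_iterate_cong[OF assms(1)] dirderiv_Basis_expansion) auto
    also have "\<dots> = (\<Sum>e\<in>Basis. (h \<bullet> e) * (dirderiv h ^^ m) (dirderiv e f) z)"
      using C z assms(3) by (intro dirderiv_iterate_linear_combination[OF assms(1)]) auto
    also have "\<bar>\<dots>\<bar> \<le> (\<Sum>e\<in>Basis. norm h * (M e * norm h ^ m))"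
      using M z Basis_le_norm
      by (intro order_trans[OF sum_abs] sum_mono) (auto simp: abs_mult intro!: mult_mono)
    also have "\<dots> = sum M Basis * norm h ^ Suc m"
      by (simp add: sum_distrib_right sum_distrib_left mult_ac)
    finally show ?thesis .
  qed
  then show ?case using sum_nonneg[of Basis M] M(1) by blast
qed

lemma dirderiv_iterate_along_line:
  assumes "open U" "Ck_on (Suc m) U f" "x + t *\<^sub>R h \<in> U"
  shows "((\<lambda>t. (dirderiv h ^^ m) f (x + t *\<^sub>R h)) has_real_derivative
     (dirderiv h ^^ Suc m) f (x + t *\<^sub>R h)) (at t)"
proof -
  let ?g = "(dirderiv h ^^ m) f" and ?p = "x + t *\<^sub>R h"
  have "?g differentiable (at ?p)"
    using Ck_on_dirderiv_iterate[OF assms(1), of m 1 f] assms(2,3) by auto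
  then have D: "(?g has_derivative frechet_derivative ?g (at ?p)) (at ?p)"
    using frechet_derivative_works by blast
  have "((\<lambda>t. x + t *\<^sub>R h) has_vector_derivative h) (at t)"
    by (auto intro!: derivative_eq_intros)
  from vector_derivative_diff_chain_within[OF this, of ?g] D
  have "(?g \<circ> (\<lambda>t. x + t *\<^sub>R h) has_vector_derivative frechet_derivative ?g (at ?p) h) (at t)"
    using has_derivative_at_withinI by blast
  then show ?thesis
    by (simp add: has_real_derivative_iff_has_vector_derivative o_def dirderiv_def)
qed

section \<open>Taylor estimates on convex compact sets\<close>

text \<open>
  This is Maclaurin's formula for \<open>t \<mapsto> (dirderiv h ^^ j) f (x + t h)\<close> with \<open>h = z - x\<close>.
  The offset \<open>j\<close> allows the expansion of a derivative of \<open>f\<close> along the same segment.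
\<close>

lemma taylor_along_segment:
  fixes f :: "'a::euclidean_space \<Rightarrow> real"
  assumes "open U" "convex K" "K \<subseteq> U" "x \<in> K" "z \<in> K" "Ck_on (j + m) U f" "m > 0"
  shows "\<exists>p\<in>K. (dirderiv (z - x) ^^ j) f z =
     (\<Sum>i<m. (dirderiv (z - x) ^^ (j + i)) f x / fact i) + (dirderiv (z - x) ^^ (j + m)) f p / fact m"
proof -
  let ?h = "z - x"
  let ?d = "\<lambda>i t. (dirderiv ?h ^^ (j + i)) f (x + t *\<^sub>R ?h)"
  have K: "x + t *\<^sub>R ?h \<in> K" if "0 \<le> t" "t \<le> 1" for t
    using convexD_alt[OF assms(2,4,5) that] by (simp add: algebra_simps)
  have "\<forall>i t. i < m \<and> 0 \<le> t \<and> t \<le> 1 \<longrightarrow> (?d i has_real_derivative ?d (Suc i) t) (at t)"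
  proof (intro allI impI)
    fix i t assume it: "i < m \<and> 0 \<le> t \<and> t \<le> (1::real)"
    then have "Ck_on (Suc (j + i)) U f" using Ck_on_mono[OF assms(6)] by (simp del: Ck_on.simps)
    then show "(?d i has_real_derivative ?d (Suc i) t) (at t)"
      using dirderiv_iterate_along_line[OF assms(1), of "j + i" f x t ?h] K[of t] it assms(3) by auto
  qed
  from Maclaurin[of 1 m ?d "?d 0", OF _ assms(7) _ this]
  obtain t where t: "0 < t" "t < 1" "?d 0 1 = (\<Sum>i<m. ?d i 0 / fact i) + ?d m t / fact m"
    by auto
  then show ?thesis using K[of t] by (intro bexI[of _ "x + t *\<^sub>R ?h"]) auto
qed

lemma Ck_on_1_lipschitz:
  fixes f :: "'a::euclidean_space \<Rightarrow> real"
  assumes "open U" "compact K" "convex K" "K \<subseteq> U" "Ck_on 1 U f"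
  shows "\<exists>L\<ge>0. \<forall>x\<in>K. \<forall>z\<in>K. \<bar>f z - f x\<bar> \<le> L * norm (z - x)"
proof -
  obtain M where M: "M \<ge> 0" "\<And>h z. z \<in> K \<Longrightarrow> \<bar>(dirderiv h ^^ 1) f z\<bar> \<le> M * norm h ^ 1"
    using dirderiv_iterate_bound[OF assms(1,2,4,5)] by blast
  have "\<bar>f z - f x\<bar> \<le> M * norm (z - x)" if "x \<in> K" "z \<in> K" for x z
    using taylor_along_segment[OF assms(1,3,4) that, of 0 1 f] assms(5) M(2)[of _ "z - x"] by auto
  then show ?thesis using M(1) by blast
qed

lemma quadratic_taylor:
  fixes f :: "'a::euclidean_space \<Rightarrow> real"
  assumes "open U" "compact K" "convex K" "K \<subseteq> U" "Ck_on 2 U f"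
  shows "\<exists>C\<ge>0. \<forall>x\<in>K. \<forall>z\<in>K. \<bar>f z - f x - dirderiv (z - x) f x\<bar> \<le> C * norm (z - x) ^ 2"
proof -
  obtain M where M: "M \<ge> 0" "\<And>h z. z \<in> K \<Longrightarrow> \<bar>(dirderiv h ^^ 2) f z\<bar> \<le> M * norm h ^ 2"
    using dirderiv_iterate_bound[OF assms(1,2,4,5)] by blast
  have "\<bar>f z - f x - dirderiv (z - x) f x\<bar> \<le> M * norm (z - x) ^ 2"
    if xz: "x \<in> K" "z \<in> K" for x z
  proof -
    obtain p where "p \<in> K"
      "f z = f x + dirderiv (z - x) f x + (dirderiv (z - x) ^^ 2) f p / 2"
      using taylor_along_segment[OF assms(1,3,4) xz, of 0 2 f] assms(5)
      by (auto simp: numeral_2_eq_2 simp del: Ck_on.simps)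
    then show ?thesis using M(2)[of p "z - x"] by (auto simp del: funpow.simps)
  qed
  then show ?thesis using M(1) by blast
qed

text \<open>
  Subtracting twice the third-order expansion of \<open>f\<close> at \<open>x\<close> from the second-order expansion of
  its derivative cancels the second derivative at \<open>x\<close>; only third derivatives remain.
\<close>

lemma trapezoidal_rule_error:
  fixes f :: "'a::euclidean_space \<Rightarrow> real"
  assumes "open U" "compact K" "convex K" "K \<subseteq> U" "Ck_on 3 U f"
  shows "\<exists>C\<ge>0. \<forall>x\<in>K. \<forall>z\<in>K.
     \<bar>dirderiv (z - x) f x + dirderiv (z - x) f z - 2 * (f z - f x)\<bar> \<le> C * norm (z - x) ^ 3"
proof -
  obtain M where M: "M \<ge> 0" "\<And>h z. z \<in> K \<Longrightarrow> \<bar>(dirderiv h ^^ 3) f z\<bar> \<le> M * norm h ^ 3"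
    using dirderiv_iterate_bound[OF assms(1,2,4,5)] by blast
  have "\<bar>dirderiv (z - x) f x + dirderiv (z - x) f z - 2 * (f z - f x)\<bar> \<le> M * norm (z - x) ^ 3"
    if xz: "x \<in> K" "z \<in> K" for x z
  proof -
    let ?D = "\<lambda>i. (dirderiv (z - x) ^^ i) f"
    obtain p where p: "p \<in> K" "?D 0 z = (\<Sum>i<3. ?D (0 + i) x / fact i) + ?D (0 + 3) p / fact 3"
      using taylor_along_segment[OF assms(1,3,4) xz, of 0 3 f] assms(5)
      by (auto simp del: Ck_on.simps)
    obtain q where q: "q \<in> K" "?D 1 z = (\<Sum>i<2. ?D (1 + i) x / fact i) + ?D (1 + 2) q / fact 2"
      using taylor_along_segment[OF assms(1,3,4) xz, of 1 2 f] assms(5)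
      by (auto simp: numeral_3_eq_3 simp del: Ck_on.simps funpow.simps)
    have "f z = f x + ?D 1 x + ?D 2 x / 2 + ?D 3 p / 6"
      using p(2) by (simp add: eval_nat_numeral)
    moreover have "?D 1 z = ?D 1 x + ?D 2 x + ?D 3 q / 2"
      using q(2) by (simp add: eval_nat_numeral)
    ultimately have "?D 1 x + ?D 1 z - 2 * (f z - f x) = ?D 3 q / 2 - ?D 3 p / 3"
      by (simp del: funpow.simps)
    moreover have "\<bar>?D 3 q\<bar> \<le> M * norm (z - x) ^ 3" "\<bar>?D 3 p\<bar> \<le> M * norm (z - x) ^ 3"
      using M(2) p(1) q(1) by blast+
    ultimately have "\<bar>?D 1 x + ?D 1 z - 2 * (f z - f x)\<bar> \<le> M * norm (z - x) ^ 3"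
      by linarith
    then show ?thesis by simp
  qed
  then show ?thesis using M(1) by blast
qed

section \<open>The gradient and the unit normal\<close>

definition grad :: "('a::euclidean_space \<Rightarrow> real) \<Rightarrow> 'a \<Rightarrow> 'a" where
  "grad f x = (\<Sum>e\<in>Basis. dirderiv e f x *\<^sub>R e)"

lemma dirderiv_eq_grad_inner:
  assumes "f differentiable (at x)"
  shows "dirderiv h f x = grad f x \<bullet> h"
  unfolding dirderiv_Basis_expansion[OF assms, of h] grad_def inner_sum_left
  by (simp add: inner_commute mult.commute)

lemma grad_lipschitz:
  fixes f :: "'a::euclidean_space \<Rightarrow> real"
  assumes "open U" "compact K" "convex K" "K \<subseteq> U" "Ck_on 2 U f"
  shows "\<exists>L\<ge>0. \<forall>x\<in>K. \<forall>z\<in>K. norm (grad f z - grad f x) \<le> L * norm (z - x)"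
proof -
  have "Ck_on 1 U (dirderiv e f)" for e
    using Ck_on_dirderiv[OF assms(1), of 1 f] assms(5) by (simp add: numeral_2_eq_2 del: Ck_on.simps)
  then have "\<forall>e. \<exists>L\<ge>0. \<forall>x\<in>K. \<forall>z\<in>K. \<bar>dirderiv e f z - dirderiv e f x\<bar> \<le> L * norm (z - x)"
    using Ck_on_1_lipschitz[OF assms(1-4)] by blast
  then obtain L where L: "\<And>e. L e \<ge> 0"
    "\<And>e x z. x \<in> K \<Longrightarrow> z \<in> K \<Longrightarrow> \<bar>dirderiv e f z - dirderiv e f x\<bar> \<le> L e * norm (z - x)"
    by metis
  have "norm (grad f z - grad f x) \<le> sum L Basis * norm (z - x)" if "x \<in> K" "z \<in> K" for x z
  proof -
    have "grad f z - grad f x = (\<Sum>e\<in>Basis. (dirderiv e f z - dirderiv e f x) *\<^sub>R e)"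
      by (simp add: grad_def sum_subtractf algebra_simps)
    also have "norm \<dots> \<le> (\<Sum>e\<in>Basis. L e * norm (z - x))"
      using L(2)[OF that] by (intro order_trans[OF norm_sum] sum_mono) auto
    finally show ?thesis by (simp add: sum_distrib_right)
  qed
  then show ?thesis using L(1) sum_nonneg[of Basis L] by blast
qed

text \<open>
  Tangent vectors are velocities of curves in the surface that have to be differentiable at 0
  only.  Therefore no implicit function theorem is needed: \<open>x + t v\<close> misses the level set by
  \<open>O(t^2)\<close>, and for each small \<open>t\<close> the intermediate value theorem gives a correction \<open>s(t)\<close> along
  the gradient, with \<open>|s(t)| \<le> K t^2\<close>, that moves the point onto it.  The function \<open>s\<close> is an
  arbitrary choice, but the bound alone forces \<open>s'(0) = 0\<close>.
\<close>

lemma orthogonal_to_grad_is_tangent: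
  fixes \<rho> :: "'a::euclidean_space \<Rightarrow> real"
  assumes "open U" "Ck_on 2 U \<rho>" "x \<in> U" "\<rho> x = 0" "grad \<rho> x \<noteq> 0"
    and S: "\<And>z. z \<in> U \<Longrightarrow> \<rho> z = 0 \<Longrightarrow> z \<in> S" and v: "grad \<rho> x \<bullet> v = 0"
  shows "v \<in> tangent_vectors S x"
proof -
  let ?g = "grad \<rho> x"
  have diff: "\<And>z. z \<in> U \<Longrightarrow> \<rho> differentiable (at z)"
    using assms(2) by (simp add: numeral_2_eq_2)
  obtain r where r: "r > 0" "cball x r \<subseteq> U"
    using assms(1,3) open_contains_cball by blast
  obtain C where C: "C \<ge> 0"
    "\<And>z. z \<in> cball x r \<Longrightarrow> \<bar>\<rho> z - \<rho> x - dirderiv (z - x) \<rho> x\<bar> \<le> C * norm (z - x) ^ 2"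
    using quadratic_taylor[OF assms(1) _ _ r(2) assms(2)] r(1)
    by (metis compact_cball convex_cball centre_in_cball less_imp_le)
  let ?m = "norm v + norm ?g"
  have m: "?m > 0" using assms(5) by (simp add: add_nonneg_pos)
  \<comment> \<open>When \<open>|s| \<le> K t^2 \<le> |t|\<close>, the displacement \<open>t v + s g\<close> has norm at most \<open>|t| m\<close>, so the
    Taylor error is at most \<open>C m^2 t^2 = K t^2 |g|^2\<close>; this is the linear term at
    \<open>s = K t^2\<close>, and so the sign of \<open>\<rho>\<close> is known at both ends.\<close>
  define K where "K = C * ?m\<^sup>2 / (norm ?g)\<^sup>2"
  have K: "K \<ge> 0" "K * (norm ?g)\<^sup>2 = C * ?m\<^sup>2" using C(1) assms(5) by (auto simp: K_def)
  define \<delta> where "\<delta> = min (r / ?m) (1 / (K + 1))"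
  have \<delta>: "\<delta> > 0" using r m K by (simp add: \<delta>_def)
  have ex: "\<exists>s. \<bar>s\<bar> \<le> K * t\<^sup>2 \<and> x + (t *\<^sub>R v + s *\<^sub>R ?g) \<in> S" if t: "\<bar>t\<bar> < \<delta>" for t
  proof -
    let ?w = "\<lambda>s. t *\<^sub>R v + s *\<^sub>R ?g"
    have "\<bar>t\<bar> * (K + 1) \<le> 1" using t K by (auto simp: \<delta>_def field_simps)
    then have "\<bar>t\<bar> * K \<le> 1" by (simp add: algebra_simps)
    then have "\<bar>t\<bar> * K * \<bar>t\<bar> \<le> 1 * \<bar>t\<bar>" by (intro mult_right_mono) auto
    then have Kt: "K * t\<^sup>2 \<le> \<bar>t\<bar>"
      by (metis abs_mult_self_eq mult.assoc mult.commute mult_1 power2_eq_square)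
    have w: "norm (?w s) \<le> \<bar>t\<bar> * ?m" if "\<bar>s\<bar> \<le> K * t\<^sup>2" for s
    proof -
      have "norm (?w s) \<le> \<bar>t\<bar> * norm v + \<bar>s\<bar> * norm ?g"
        by (rule order_trans[OF norm_triangle_ineq]) simp
      also have "\<dots> \<le> \<bar>t\<bar> * norm v + \<bar>t\<bar> * norm ?g"
        using that Kt by (intro add_left_mono mult_right_mono) auto
      finally show ?thesis by (simp add: algebra_simps)
    qed
    have wr: "x + ?w s \<in> cball x r" if "\<bar>s\<bar> \<le> K * t\<^sup>2" for s
    proof -
      have "\<bar>t\<bar> * ?m \<le> r" using t m by (auto simp: \<delta>_def field_simps)
      then show ?thesis using w[OF that] norm_minus_cancel[of "?w s"]
        by (simp add: dist_norm del: norm_minus_cancel)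
    qed
    have est: "\<bar>\<rho> (x + ?w s) - s * (norm ?g)\<^sup>2\<bar> \<le> K * t\<^sup>2 * (norm ?g)\<^sup>2" if "\<bar>s\<bar> \<le> K * t\<^sup>2" for s
    proof -
      have "dirderiv (?w s) \<rho> x = s * (norm ?g)\<^sup>2"
        using dirderiv_eq_grad_inner[OF diff[OF assms(3)]] v
        by (simp add: inner_add_right dot_square_norm)
      then have "\<bar>\<rho> (x + ?w s) - s * (norm ?g)\<^sup>2\<bar> \<le> C * norm (?w s) ^ 2"
        using C(2)[OF wr[OF that]] assms(4) by simp
      also have "\<dots> \<le> C * (\<bar>t\<bar> * ?m)\<^sup>2"
        using w[OF that] C(1) by (intro mult_left_mono power_mono) auto
      also have "\<dots> = K * t\<^sup>2 * (norm ?g)\<^sup>2" using K(2) by (simp add: power_mult_distrib)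
      finally show ?thesis .
    qed
    have Kt0: "K * t\<^sup>2 \<ge> 0" using K by simp
    have cont: "continuous_on {- (K * t\<^sup>2) .. K * t\<^sup>2} (\<lambda>s. \<rho> (x + ?w s))"
    proof (rule continuous_on_compose2[of U \<rho>])
      show "continuous_on U \<rho>" using Ck_on_mono[OF assms(2), of 0] by simp
      show "(\<lambda>s. x + ?w s) ` {- (K * t\<^sup>2) .. K * t\<^sup>2} \<subseteq> U"
        using wr r(2) by (auto simp: abs_le_iff)
    qed (intro continuous_intros)
    have lo: "\<rho> (x + ?w (- (K * t\<^sup>2))) \<le> 0" using est[of "- (K * t\<^sup>2)"] Kt0 by (simp add: abs_le_iff)
    have hi: "0 \<le> \<rho> (x + ?w (K * t\<^sup>2))" using est[of "K * t\<^sup>2"] Kt0 by (simp add: abs_le_iff)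
    obtain s where s: "- (K * t\<^sup>2) \<le> s" "s \<le> K * t\<^sup>2" "\<rho> (x + ?w s) = 0"
      using IVT'[OF lo hi _ cont] Kt0 by auto
    then have "\<bar>s\<bar> \<le> K * t\<^sup>2" by simp
    then show ?thesis using s(3) S wr r(2) by blast
  qed
  then obtain s where s: "\<And>t. \<bar>t\<bar> < \<delta> \<Longrightarrow> \<bar>s t\<bar> \<le> K * t\<^sup>2 \<and> x + (t *\<^sub>R v + s t *\<^sub>R ?g) \<in> S"
    by metis
  define c where "c t = x + (t *\<^sub>R v + s t *\<^sub>R ?g)" for t
  have s0: "s 0 = 0" using s[of 0] \<delta> by simp
  have ev: "\<forall>\<^sub>F t in at 0. \<bar>t\<bar> < \<delta>"
    using \<delta> unfolding eventually_at by (intro exI[of _ \<delta>]) auto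
  have "(s has_real_derivative 0) (at 0)"
  proof -
    have "((\<lambda>t. K * \<bar>t\<bar>) \<longlongrightarrow> 0) (at 0)"
      by (auto intro!: tendsto_eq_intros)
    moreover have "\<forall>\<^sub>F t in at 0. norm ((s (0 + t) - s 0) / t) \<le> K * \<bar>t\<bar>"
      using ev
    proof eventually_elim
      case (elim t)
      have "\<bar>s t\<bar> \<le> K * \<bar>t\<bar> * \<bar>t\<bar>"
        using s[OF elim] by (simp add: power2_eq_square mult.assoc)
      then show ?case using s0 by (cases "t = 0") (auto simp: divide_le_eq)
    qed
    ultimately show ?thesis unfolding DERIV_def by (rule Lim_null_comparison[rotated])
  qed
  then have "(c has_vector_derivative v) (at 0)"
    unfolding c_def by (auto intro!: derivative_eq_intros)
  moreover have "c 0 = x" using s0 by (simp add: c_def)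
  moreover have "\<forall>\<^sub>F t in at 0. c t \<in> S"
    using ev by eventually_elim (use s c_def in auto)
  ultimately show ?thesis unfolding tangent_vectors_def by blast
qed

text \<open>
  Orthogonality to all tangent vectors makes \<open>\<nu>\<close> a multiple of the gradient, and its length
  fixes the multiple up to sign.  A negative sign would make \<open>\<rho>\<close> decrease along \<open>\<nu>\<close>, so that
  \<open>\<nu>\<close> would point into \<open>\<Omega>\<close>.
\<close>

lemma outward_unit_normal_eq_normalized_grad:
  fixes \<rho> :: "'a::euclidean_space \<Rightarrow> real"
  assumes "open U" "Ck_on 2 U \<rho>" "x \<in> U" "x \<in> frontier \<Omega>" "grad \<rho> x \<noteq> 0"
    and in\<Omega>: "\<Omega> \<inter> U = {x\<in>U. \<rho> x < 0}"
    and front: "frontier \<Omega> \<inter> U = {x\<in>U. \<rho> x = 0}"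
    and \<nu>: "is_outward_unit_normal \<Omega> x \<nu>"
  shows "\<nu> = grad \<rho> x /\<^sub>R norm (grad \<rho> x)"
proof -
  let ?g = "grad \<rho> x"
  have diff: "\<rho> differentiable (at x)"
    using assms(2,3) by (simp add: numeral_2_eq_2)
  have \<rho>x: "\<rho> x = 0" using front assms(3,4) by blast
  define l where "l = (\<nu> \<bullet> ?g) / (?g \<bullet> ?g)"
  have gg: "?g \<bullet> ?g > 0" using assms(5) by simp
  \<comment> \<open>The component of \<open>\<nu>\<close> orthogonal to the gradient is tangent, hence orthogonal to \<open>\<nu>\<close> and
    so to itself.\<close>
  define v where "v = \<nu> - l *\<^sub>R ?g"
  have gv: "?g \<bullet> v = 0" using gg by (simp add: v_def l_def inner_diff_right inner_commute)
  then have "v \<in> tangent_vectors (frontier \<Omega>) x"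
    using front by (intro orthogonal_to_grad_is_tangent[OF assms(1-3) \<rho>x assms(5)]) auto
  then have "\<nu> \<bullet> v = 0" using \<nu> unfolding is_outward_unit_normal_def by blast
  then have "v \<bullet> v = 0" using gv by (simp add: v_def inner_diff_left inner_diff_right inner_commute)
  then have \<nu>l: "\<nu> = l *\<^sub>R ?g" by (simp add: v_def)
  have n1: "\<bar>l\<bar> * norm ?g = 1" using \<nu> \<nu>l unfolding is_outward_unit_normal_def by (metis norm_scaleR)
  have "l > 0"
  proof (rule ccontr)
    assume "\<not> l > 0"
    then have l: "l < 0" using n1 by (cases "l = 0") auto
    have "((\<lambda>t. \<rho> (x + t *\<^sub>R \<nu>)) has_real_derivative dirderiv \<nu> \<rho> x) (at 0)"
      using dirderiv_iterate_along_line[OF assms(1), of 0 \<rho> x 0 \<nu>] Ck_on_mono[OF assms(2), of 1]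
        assms(3) by simp
    moreover have "dirderiv \<nu> \<rho> x < 0"
      using dirderiv_eq_grad_inner[OF diff] \<nu>l l gg by (simp add: mult_neg_pos)
    ultimately obtain d where d: "d > 0" "\<And>t. 0 < t \<Longrightarrow> t < d \<Longrightarrow> \<rho> (x + t *\<^sub>R \<nu>) < 0"
      using DERIV_neg_dec_right[of "\<lambda>t. \<rho> (x + t *\<^sub>R \<nu>)" _ 0] \<rho>x by auto
    have e1: "\<forall>\<^sub>F t in at_right 0. 0 < t \<and> t < d"
      using d(1) by (simp add: eventually_at_right_less eventually_conj eventually_at_right_real
        eventually_at_right_field) (use d(1) in blast)
    have "((\<lambda>t. x + t *\<^sub>R \<nu>) \<longlongrightarrow> x) (at_right 0)"
      by (auto intro!: tendsto_eq_intros)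
    then have e2: "\<forall>\<^sub>F t in at_right 0. x + t *\<^sub>R \<nu> \<in> U"
      using assms(1,3) topological_tendstoD by blast
    have e3: "\<forall>\<^sub>F t in at_right 0. x + t *\<^sub>R \<nu> \<notin> closure \<Omega>"
      using \<nu> unfolding is_outward_unit_normal_def by blast
    have "\<forall>\<^sub>F t in at_right (0::real). False"
      using e1 e2 e3
    proof eventually_elim
      case (elim t)
      then have "x + t *\<^sub>R \<nu> \<in> \<Omega>" using d(2) in\<Omega> by blast
      then show False using elim closure_subset by blast
    qed
    then show False by (simp add: trivial_limit_at_right_real)
  qed
  then have "l = inverse (norm ?g)" using n1 assms(5) by (simp add: field_simps)
  then show ?thesis using \<nu>l by simp
qed

section \<open>Cancellation of the singularity\<close>

theorem mainTheorem1:
  fixes \<Omega> S :: "(real^3) set"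
    and n :: "real^3 \<Rightarrow> real^3"
    and f :: "real^3 \<Rightarrow> real"
    and y :: "real^3"
  assumes "bounded_smooth_domain \<Omega>"
    and "S = frontier \<Omega>"
    and "\<And>x. x \<in> S \<Longrightarrow> is_outward_unit_normal \<Omega> x (n x)"
    and "smooth_on_surface S f"
    and "y \<in> S"
  shows "\<exists>U. open U \<and> y \<in> U \<and>
    bounded (modified_adjoint_integrand n f y ` ((S \<inter> U) - {y}))"
proof -
  obtain U and \<rho> :: "real^3 \<Rightarrow> real" where U: "y \<in> U" "smooth_on_open U \<rho>"
      "\<And>x. x \<in> U \<Longrightarrow> frechet_derivative \<rho> (at x) \<noteq> (\<lambda>v. 0)"
      "\<Omega> \<inter> U = {x\<in>U. \<rho> x < 0}" "frontier \<Omega> \<inter> U = {x\<in>U. \<rho> x = 0}"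
    using bspec[OF assms(1)[unfolded bounded_smooth_domain_def smooth_boundary_def,
          THEN conjunct2, THEN conjunct2, THEN conjunct2, THEN conjunct2]
        assms(5)[unfolded assms(2)]]
    by (elim exE conjE) (rule that, assumption+, simp_all)
  obtain V and F :: "real^3 \<Rightarrow> real" where V: "y \<in> V" "smooth_on_open V F" "\<And>x. x \<in> S \<inter> V \<Longrightarrow> f x = F x"
    using bspec[OF assms(4)[unfolded smooth_on_surface_def] assms(5)]
    by (elim exE conjE) (rule that, assumption+, simp)
  have op: "open U" "open V" and Ck: "\<And>k. Ck_on k U \<rho>" "\<And>k. Ck_on k V F"
    using U(2) V(2) by (auto simp: smooth_on_open_def)
  obtain r where r: "r > 0" "cball y r \<subseteq> U \<inter> V"
    using open_Int[OF op] U(1) V(1) unfolding open_contains_cball by blast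
  define K where "K = cball y r"
  have K: "compact K" "convex K" "K \<subseteq> U" "K \<subseteq> V" "y \<in> K"
    using r by (auto simp: K_def)
  let ?g = "grad \<rho>"
  have diff: "\<rho> differentiable (at x)" if "x \<in> U" for x
    using Ck(1)[of 1] that by simp
  have dd: "dirderiv h \<rho> x = ?g x \<bullet> h" if "x \<in> U" for x h
    using dirderiv_eq_grad_inner[OF diff[OF that]] .
  have g0: "?g x \<noteq> 0" if "x \<in> U" for x
  proof
    assume "?g x = 0"
    then have "frechet_derivative \<rho> (at x) = (\<lambda>v. 0)"
      using dd[OF that] unfolding dirderiv_def by auto
    then show False using U(3)[OF that] by blast
  qed
  have normal: "n x = ?g x /\<^sub>R norm (?g x)" "\<rho> x = 0" if "x \<in> S" "x \<in> K" for x
    using outward_unit_normal_eq_normalized_grad[OF op(1) Ck(1) _ _ g0 U(4,5) assms(3)]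
      that K(3) assms(2) U(5) by auto
  obtain L where L: "L \<ge> 0" "\<And>x z. x \<in> K \<Longrightarrow> z \<in> K \<Longrightarrow> \<bar>F z - F x\<bar> \<le> L * norm (z - x)"
    using Ck_on_1_lipschitz[OF op(2) K(1,2,4) Ck(2)] by blast
  obtain G where G: "G \<ge> 0" "\<And>x z. x \<in> K \<Longrightarrow> z \<in> K \<Longrightarrow> norm (?g z - ?g x) \<le> G * norm (z - x)"
    using grad_lipschitz[OF op(1) K(1-3) Ck(1)] by blast
  obtain C where C: "C \<ge> 0" "\<And>x z. x \<in> K \<Longrightarrow> z \<in> K \<Longrightarrow>
      \<bar>\<rho> z - \<rho> x - dirderiv (z - x) \<rho> x\<bar> \<le> C * norm (z - x) ^ 2"
    using quadratic_taylor[OF op(1) K(1-3) Ck(1)] by blast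
  obtain T where T: "T \<ge> 0" "\<And>x z. x \<in> K \<Longrightarrow> z \<in> K \<Longrightarrow>
      \<bar>dirderiv (z - x) \<rho> x + dirderiv (z - x) \<rho> z - 2 * (\<rho> z - \<rho> x)\<bar> \<le> T * norm (z - x) ^ 3"
    using trapezoidal_rule_error[OF op(1) K(1-3) Ck(1)] by blast
  have "continuous_on K ?g"
    using G by (intro lipschitz_on_continuous_on[of G] lipschitz_onI)
      (auto simp: dist_norm norm_minus_commute)
  then have "continuous_on K (\<lambda>x. inverse (norm (?g x)))"
    using g0 K(3) by (intro continuous_intros) auto
  then have "bounded ((\<lambda>x. inverse (norm (?g x))) ` K)"
    using K(1) compact_continuous_image compact_imp_bounded by blast
  then obtain A where A: "A > 0" "\<And>x. x \<in> K \<Longrightarrow> inverse (norm (?g x)) \<le> A"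
    unfolding bounded_pos by auto
  let ?B = "L * (A * C) + \<bar>f y\<bar> * (A * T + A * A * G * C)"
  have bound: "\<bar>(f x *\<^sub>R n y + f y *\<^sub>R n x) \<bullet> (y - x)\<bar> \<le> ?B * norm (x - y) ^ 3"
    if x: "x \<in> S" "x \<in> K" for x
  proof -
    define d where "d = norm (x - y)"
    define a where "a = inverse (norm (?g x))"
    define b where "b = inverse (norm (?g y))"
    have d: "d \<ge> 0" "norm (y - x) = d" by (auto simp: d_def norm_minus_commute)
    have ab: "0 \<le> a" "a \<le> A" "0 \<le> b" "b \<le> A" using A(2) x(2) K(5) by (auto simp: a_def b_def)
    have gx: "?g x \<noteq> 0" "?g y \<noteq> 0" using g0 x(2) K by auto
    have \<rho>: "\<rho> x = 0" "\<rho> y = 0" using normal(2) x assms(5) K(5) by auto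
    have n: "n x = a *\<^sub>R ?g x" "n y = b *\<^sub>R ?g y"
      using normal(1) x assms(5) K(5) by (auto simp: a_def b_def)
    define q where "q = ?g y \<bullet> (y - x)"
    define p where "p = (?g x + ?g y) \<bullet> (y - x)"
    have "\<bar>?g y \<bullet> (x - y)\<bar> \<le> C * d ^ 2"
      using C(2)[OF K(5) x(2)] \<rho> dd[of y] K by (auto simp: d_def)
    moreover have "?g y \<bullet> (x - y) = - q" by (simp add: q_def inner_diff_right)
    ultimately have q: "\<bar>q\<bar> \<le> C * d ^ 2" by simp
    have p: "\<bar>p\<bar> \<le> T * d ^ 3"
      using T(2)[OF x(2) K(5)] \<rho> dd[of y "y - x"] dd[of x "y - x"] K(3,5) x(2) d(2)
      by (simp add: p_def inner_add_left subset_iff)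
    have "f x = F x" "f y = F y" using V(3) x assms(5) K(4,5) by blast+
    then have F: "\<bar>f x - f y\<bar> \<le> L * d"
      using L(2)[OF K(5) x(2)] by (simp add: d_def)
    have "\<bar>norm (?g x) - norm (?g y)\<bar> \<le> G * d"
      using G(2)[OF K(5) x(2)] norm_triangle_ineq3[of "?g x" "?g y"] by (simp add: d_def)
    moreover have "b - a = a * b * (norm (?g x) - norm (?g y))"
      using gx by (simp add: a_def b_def field_simps)
    ultimately have "\<bar>b - a\<bar> \<le> a * b * (G * d)"
      using ab by (simp add: abs_mult mult_left_mono)
    also have "\<dots> \<le> A * A * (G * d)"
      using ab G(1) d A(1) by (intro mult_right_mono mult_mono) auto
    finally have ba: "\<bar>b - a\<bar> \<le> A * A * G * d" by (simp add: mult.assoc)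
    have "(f x *\<^sub>R n y + f y *\<^sub>R n x) \<bullet> (y - x) = (f x - f y) * (b * q) + f y * (a * p + (b - a) * q)"
      by (simp add: n p_def q_def inner_add_left algebra_simps)
    also have "\<bar>\<dots>\<bar> \<le> \<bar>f x - f y\<bar> * (b * \<bar>q\<bar>) + \<bar>f y\<bar> * (a * \<bar>p\<bar> + \<bar>b - a\<bar> * \<bar>q\<bar>)"
    proof -
      have "\<bar>a * p + (b - a) * q\<bar> \<le> a * \<bar>p\<bar> + \<bar>b - a\<bar> * \<bar>q\<bar>"
        using abs_triangle_ineq[of "a * p" "(b - a) * q"] ab by (simp add: abs_mult)
      then have "\<bar>f y * (a * p + (b - a) * q)\<bar> \<le> \<bar>f y\<bar> * (a * \<bar>p\<bar> + \<bar>b - a\<bar> * \<bar>q\<bar>)"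
        by (simp add: abs_mult mult_left_mono)
      moreover have "\<bar>(f x - f y) * (b * q)\<bar> = \<bar>f x - f y\<bar> * (b * \<bar>q\<bar>)"
        using ab by (simp add: abs_mult)
      ultimately show ?thesis
        using abs_triangle_ineq[of "(f x - f y) * (b * q)" "f y * (a * p + (b - a) * q)"] by linarith
    qed
    also have "\<dots> \<le> (L * d) * (A * (C * d ^ 2)) +
        \<bar>f y\<bar> * (A * (T * d ^ 3) + (A * A * G * d) * (C * d ^ 2))"
      using F q p ba ab A(1) L(1) C(1) T(1) G(1) d
      by (intro add_mono mult_mono) auto
    also have "\<dots> = ?B * d ^ 3" by (simp add: algebra_simps power2_eq_square power3_eq_cube)
    finally show ?thesis by (simp add: d_def)
  qed
  have "norm (modified_adjoint_integrand n f y x) \<le> ?B / (4 * pi)" if "x \<in> (S \<inter> ball y r) - {y}" for x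
  proof -
    have "norm (x - y) ^ 3 > 0" using that by simp
    moreover have "x \<in> S" "x \<in> K" using that by (auto simp: K_def)
    ultimately show ?thesis
      using bound[of x] by (simp add: modified_adjoint_integrand_def abs_mult field_simps)
  qed
  then have "bounded (modified_adjoint_integrand n f y ` ((S \<inter> ball y r) - {y}))"
    unfolding bounded_iff by blast
  then show ?thesis using r(1) by (intro exI[of _ "ball y r"]) auto
qed

end
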